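(* There exists a unique bilinear form $(\cdot,\cdot)$ on ${}'\mathbf f^\pi$ with values in $\mathbb Q(q)^\pi$ such that $(1,1)=1$ and (a) $(\theta_i,\theta_j)=\delta_{ij}(1-\pi_iq_i^{2})^{-1}$ for all $i,j\in I$; (b) $(x,y'y'')=(r(x),y'\otimes y'')$ for all $x,y',y''\in{}'\mathbf f^\pi$; (c) $(xx',y'')=(x\otimes x',r(y''))$ for all $x,x',y''\in{}'\mathbf f^\pi$; (d) the induced bilinear form $({}'\mathbf f^\pi\otimes{}'\mathbf f^\pi)\times({}'\mathbf f^\pi\otimes{}'\mathbf f^\pi)\to\mathbb Q(q)^\pi$ used in (b) and (c) is given by $(x'\otimes x'',y'\otimes y''):=(x',y')(x'',y'')$. Moreover, the bilinear form $(\cdot,\cdot)$ is symmetric.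
   Context: $I=I_{\bar0}\sqcup I_{\bar1}$ is a finite $\mathbb Z_2$-graded set, with $p(i)=0$ for $i\in I_{\bar0}$ and $p(i)=1$ for $i\in I_{\bar1}$. $A=(a_{ij})_{i,j\in I}$ is a generalized Cartan matrix with: (C1) $a_{ii}=2$; (C2) $a_{ij}\in\mathbb Z_{\le0}$ for $i\neq j$; (C3) $a_{ij}=0$ iff $a_{ji}=0$; (C4) $a_{ij}\in2\mathbb Z$ for $i\in I_{\bar1}$, $j\in I$; (C5) there are positive integers $s_i$ ($i\in I$) with $\gcd=1$ such that $\mathrm{diag}(s_i)A$ is symmetric; (C6) $I_{\bar1}\ne\emptyset$, and $s_i$ is odd iff $i\in I_{\bar1}$. $Q=\bigoplus_{i\in I}\mathbb Z\alpha_i$ and $Q^+=\bigoplus_{i\in I}\mathbb Z_{\ge0}\alpha_i$, with the symmetric bilinear pairing $(\alpha_i,\alpha_j)=s_ia_{ij}$ on $Q$. For a ring $R$, $R^\pi=R[\pi]/(\pi^2-1)$. Set $q_i=q^{s_i}$, $\pi_i=\pi^{p(i)}$. ${}'\mathbf f^\pi$ is the free associative $\mathbb Q(q)^\pi$-algebra generated by $\theta_i$ ($i\in I$), where $\theta_i$ has parity $p(i)$ and weight $\alpha_i$; this gives ${}'\mathbf f^\pi$ a $\mathbb Z_2$-grading (parity $p(x)$) and a $Q^+$-grading (weight $|x|$). The tensor product (over $\mathbb Q(q)^\pi$) ${}'\mathbf f^\pi\otimes{}'\mathbf f^\pi$ is an algebra with product, for homogeneous elements, $(x_1\otimes x_2)(x_1'\otimes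 x_2')=\pi^{p(x_2)p(x_1')}q^{-(|x_2|,|x_1'|)}x_1x_1'\otimes x_2x_2'$. The map $r:{}'\mathbf f^\pi\to{}'\mathbf f^\pi\otimes{}'\mathbf f^\pi$ is the algebra homomorphism with $r(\theta_i)=\theta_i\otimes1+1\otimes\theta_i$ for all $i\in I$. *)

theory Defs
  imports
    "HOL-Library.Poly_Mapping"
    "HOL-Computational_Algebra.Polynomial"
    "HOL-Computational_Algebra.Fraction_Field"
begin

text \<open>The ring \<open>R[\<pi>]/(\<pi>\<^sup>2 - 1)\<close>\<close>

quotient_type (overloaded) 'a pi_ext = "'a::comm_ring_1 poly" /
  "\<lambda>f g. [:- 1, 0, 1:] dvd (f - g)"
proof (rule equivpI)
  show "reflp (\<lambda>f g. [:- 1, 0, 1::'a:] dvd (f - g))"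
    by (simp add: reflp_def)
  show "symp (\<lambda>f g. [:- 1, 0, 1::'a:] dvd (f - g))"
    by (intro sympI) (metis dvd_minus_iff minus_diff_eq)
  show "transp (\<lambda>f g. [:- 1, 0, 1::'a:] dvd (f - g))"
  proof (rule transpI)
    fix x y z :: "'a poly"
    assume "[:- 1, 0, 1::'a:] dvd (x - y)" "[:- 1, 0, 1::'a:] dvd (y - z)"
    then have "[:- 1, 0, 1::'a:] dvd ((x - y) + (y - z))" by (rule dvd_add)
    then show "[:- 1, 0, 1::'a:] dvd (x - z)" by simp
  qed
qed

instantiation pi_ext :: (comm_ring_1) comm_ring_1
begin

lift_definition zero_pi_ext :: "'a pi_ext" is 0 .

lift_definition one_pi_ext :: "'a pi_ext" is 1 .

lift_definition plus_pi_ext :: "'a pi_ext \<Rightarrow> 'a pi_ext \<Rightarrow> 'a pi_ext" is "(+)"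
  by (simp add: add_diff_add dvd_add)

lift_definition uminus_pi_ext :: "'a pi_ext \<Rightarrow> 'a pi_ext" is uminus
  by (metis dvd_minus_iff minus_diff_minus)

lift_definition minus_pi_ext :: "'a pi_ext \<Rightarrow> 'a pi_ext \<Rightarrow> 'a pi_ext" is "(-)"
proof -
  fix f f' g g' :: "'a poly"
  assume "[:- 1, 0, 1:] dvd (f - f')" "[:- 1, 0, 1:] dvd (g - g')"
  then have "[:- 1, 0, 1:] dvd ((f - f') - (g - g'))" by (rule dvd_diff)
  then show "[:- 1, 0, 1:] dvd (f - g - (f' - g'))" by (simp add: algebra_simps)
qed

lift_definition times_pi_ext :: "'a pi_ext \<Rightarrow> 'a pi_ext \<Rightarrow> 'a pi_ext" is "(*)"
proof -
  fix f f' g g' :: "'a poly"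
  assume "[:- 1, 0, 1:] dvd (f - f')" "[:- 1, 0, 1:] dvd (g - g')"
  then have "[:- 1, 0, 1:] dvd ((f - f') * g + f' * (g - g'))"
    by (intro dvd_add dvd_mult dvd_mult2)
  then show "[:- 1, 0, 1:] dvd (f * g - f' * g')" by (simp add: algebra_simps)
qed

instance
proof
  show "(0 :: 'a pi_ext) \<noteq> 1"
  proof transfer
    show "\<not> [:- 1, 0, 1:] dvd (0 - 1 :: 'a poly)"
    proof
      assume "[:- 1, 0, 1:] dvd (0 - 1 :: 'a poly)"
      then obtain k where "0 - 1 = [:- 1, 0, 1:] * (k :: 'a poly)" by (rule dvdE)
      then have "poly (0 - 1) 1 = poly ([:- 1, 0, 1:] * (k :: 'a poly)) 1" by simp
      then show False by simp
    qed
  qed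
qed (transfer, simp add: algebra_simps)+

end

lift_definition of_base :: "'a::comm_ring_1 \<Rightarrow> 'a pi_ext" is "\<lambda>c. [:c:]" .

lift_definition pi_var :: "'a::comm_ring_1 pi_ext" is "[:0, 1:]" .

lemma pi_var_square: "pi_var * pi_var = (1 :: 'a::comm_ring_1 pi_ext)"
  by transfer (simp add: one_pCons)

lemma of_base_1 [simp]: "of_base 1 = 1"
  by transfer (simp add: one_pCons)

lemma of_base_add: "of_base (x + y) = of_base x + of_base y"
  by transfer simp

lemma of_base_mult: "of_base (x * y) = of_base x * of_base y"
  by transfer simp

text \<open>The inverse of a unit of a commutative ring; unspecified on non-units.\<close>

definition unit_inv :: "'a::comm_ring_1 \<Rightarrow> 'a" where
  "unit_inv x = (THE y. x * y = 1)"

lemma unit_inv_eqI: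
  assumes "x * y = 1"
  shows "unit_inv x = y"
  unfolding unit_inv_def
proof (rule the_equality)
  fix z assume z: "x * z = 1"
  have "z = z * (x * y)" using assms by simp
  also have "\<dots> = (x * z) * y" by (simp only: ac_simps)
  finally show "z = y" using z by simp
qed (fact assms)

type_synonym ratq = "rat poly fract"

type_synonym coeff_ring = "ratq pi_ext"

definition qvar :: ratq where
  "qvar = Fract [:0, 1:] 1"

datatype 'i word = Word (letters: "'i list")

text \<open>
  Words in the alphabet \<open>I\<close> form the free monoid on \<open>I\<close>, written additively so that
  \<^typ>\<open>'i word \<Rightarrow>\<^sub>0 'r\<close> carries the monoid algebra structure of the library: it is
  the free associative algebra on \<open>I\<close>.
\<close>

instantiation word :: (type) monoid_add
begin

definition zero_word :: "'a word" where
  "0 = Word []"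

definition plus_word :: "'a word \<Rightarrow> 'a word \<Rightarrow> 'a word" where
  "u + v = Word (letters u @ letters v)"

instance
  by standard (simp_all add: zero_word_def plus_word_def)

end

type_synonym 'i free_alg = "'i word \<Rightarrow>\<^sub>0 coeff_ring"

definition gen :: "'i \<Rightarrow> 'i free_alg" ("\<theta>") where
  "\<theta> i = Poly_Mapping.single (Word [i]) 1"

definition fscale :: "'r::comm_ring_1 \<Rightarrow> ('b \<Rightarrow>\<^sub>0 'r) \<Rightarrow> ('b \<Rightarrow>\<^sub>0 'r)" where
  "fscale c x = Poly_Mapping.map ((*) c) x"

definition lin_extend :: "('r::comm_ring_1 \<Rightarrow> 'm::ab_group_add \<Rightarrow> 'm) \<Rightarrow> ('b \<Rightarrow> 'm) \<Rightarrow> ('b \<Rightarrow>\<^sub>0 'r) \<Rightarrow> 'm"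
  where
  "lin_extend sc f x = (\<Sum>b\<in>Poly_Mapping.keys x. sc (Poly_Mapping.lookup x b) (f b))"

lemma lookup_fscale [simp]: "Poly_Mapping.lookup (fscale c x) b = c * Poly_Mapping.lookup x b"
  unfolding fscale_def by transfer (simp add: when_def)

lemma fscale_single [simp]:
  "fscale c (Poly_Mapping.single b d) = Poly_Mapping.single b (c * d)"
  by (rule poly_mapping_eqI) (simp add: lookup_single when_def)

lemma module_fscale: "module (fscale :: 'r::comm_ring_1 \<Rightarrow> _)"
  by standard (rule poly_mapping_eqI; simp add: lookup_add algebra_simps)+

lemma module_mult: "module ((*) :: 'r::comm_ring_1 \<Rightarrow> _)"
  by standard (simp_all add: algebra_simps)

lemma fscale_conv_mult: "fscale c (x :: 'i word \<Rightarrow>\<^sub>0 'r::comm_ring_1) = Poly_Mapping.single 0 c * x"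
  by (simp add: fscale_def mult_map_scale_conv_mult)

lemma lin_extend_superset:
  assumes "module sc" "finite S" "Poly_Mapping.keys x \<subseteq> S"
  shows "lin_extend sc f x = (\<Sum>b\<in>S. sc (Poly_Mapping.lookup x b) (f b))"
  unfolding lin_extend_def
  by (rule sum.mono_neutral_left)
    (use assms in \<open>auto simp: in_keys_iff module.scale_zero_left\<close>)

lemma module_hom_lin_extend:
  fixes f :: "'b \<Rightarrow> 'm::ab_group_add"
    and sc :: "'r::comm_ring_1 \<Rightarrow> 'm \<Rightarrow> 'm"
  assumes "module sc"
  shows "module_hom fscale sc (lin_extend sc f)"
proof -
  interpret module sc by fact
  show ?thesis
  proof (intro module_hom.intro module_fscale assms module_hom_axioms.intro)
    fix x y :: "'b \<Rightarrow>\<^sub>0 'r"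
    let ?S = "Poly_Mapping.keys x \<union> Poly_Mapping.keys y"
    have "lin_extend sc f (x + y) = (\<Sum>b\<in>?S. sc (Poly_Mapping.lookup (x + y) b) (f b))"
      using Poly_Mapping.keys_add[of x y] by (intro lin_extend_superset assms) auto
    moreover have "lin_extend sc f x = (\<Sum>b\<in>?S. sc (Poly_Mapping.lookup x b) (f b))"
      by (intro lin_extend_superset assms) auto
    moreover have "lin_extend sc f y = (\<Sum>b\<in>?S. sc (Poly_Mapping.lookup y b) (f b))"
      by (intro lin_extend_superset assms) auto
    ultimately show "lin_extend sc f (x + y) = lin_extend sc f x + lin_extend sc f y"
      by (simp add: lookup_add scale_left_distrib sum.distrib)
  next
    fix c and x :: "'b \<Rightarrow>\<^sub>0 'r"
    have "lin_extend sc f (fscale c x)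
        = (\<Sum>b\<in>Poly_Mapping.keys x. sc (Poly_Mapping.lookup (fscale c x) b) (f b))"
      by (intro lin_extend_superset assms) (auto simp: in_keys_iff)
    then show "lin_extend sc f (fscale c x) = sc c (lin_extend sc f x)"
      by (simp add: lin_extend_def scale_sum_right)
  qed
qed

lemma lin_extend_single:
  assumes "module sc"
  shows "lin_extend sc f (Poly_Mapping.single b c) = sc c (f b)"
proof -
  have "lin_extend sc f (Poly_Mapping.single b c)
      = (\<Sum>k\<in>{b}. sc (Poly_Mapping.lookup (Poly_Mapping.single b c) k) (f k))"
    by (rule lin_extend_superset[OF assms]) (auto simp: in_keys_iff lookup_single when_def)
  then show ?thesis by simp
qed

lemma poly_mapping_sum_single:
  "x = (\<Sum>b\<in>Poly_Mapping.keys x. fscale (Poly_Mapping.lookup x b) (Poly_Mapping.single b 1))"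
  by (rule poly_mapping_eqI)
    (auto simp: lookup_sum lookup_single when_def in_keys_iff if_distrib cong: if_cong)

lemma module_hom_sum:
  assumes "module_hom s1 s2 f"
  shows "f (sum g A) = (\<Sum>x\<in>A. f (g x))"
proof -
  interpret module_hom s1 s2 f by fact
  show ?thesis by (rule sum)
qed

lemma module_hom_expand:
  fixes f :: "('b \<Rightarrow>\<^sub>0 'r::comm_ring_1) \<Rightarrow> 'm::ab_group_add"
  assumes "module_hom fscale sc f"
  shows "f x = (\<Sum>b\<in>Poly_Mapping.keys x. sc (Poly_Mapping.lookup x b) (f (Poly_Mapping.single b 1)))"
proof -
  have "f x = f (\<Sum>b\<in>Poly_Mapping.keys x.
      fscale (Poly_Mapping.lookup x b) (Poly_Mapping.single b 1))"
    using poly_mapping_sum_single[of x] by simp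
  also have "\<dots> = (\<Sum>b\<in>Poly_Mapping.keys x.
      f (fscale (Poly_Mapping.lookup x b) (Poly_Mapping.single b 1)))"
    by (rule module_hom_sum[OF assms])
  also have "\<dots> = (\<Sum>b\<in>Poly_Mapping.keys x.
      sc (Poly_Mapping.lookup x b) (f (Poly_Mapping.single b 1)))"
    by (intro sum.cong refl module_hom.scale[OF assms])
  finally show ?thesis .
qed

lemma module_hom_eqI_keys:
  fixes f g :: "('b \<Rightarrow>\<^sub>0 'r::comm_ring_1) \<Rightarrow> 'm::ab_group_add"
  assumes "module_hom fscale sc f" "module_hom fscale sc g"
    and "\<And>b. b \<in> Poly_Mapping.keys x \<Longrightarrow> f (Poly_Mapping.single b 1) = g (Poly_Mapping.single b 1)"
  shows "f x = g x"
  unfolding module_hom_expand[OF assms(1), of x] module_hom_expand[OF assms(2), of x]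
  by (intro sum.cong refl) (simp add: assms(3))

lemma module_hom_eqI:
  fixes f g :: "('b \<Rightarrow>\<^sub>0 'r::comm_ring_1) \<Rightarrow> 'm::ab_group_add"
  assumes "module_hom fscale sc f" "module_hom fscale sc g"
    and "\<And>b. f (Poly_Mapping.single b 1) = g (Poly_Mapping.single b 1)"
  shows "f x = g x"
  using assms by (rule module_hom_eqI_keys)

lemma module_hom_fscale: "module_hom fscale fscale (fscale (c :: 'r::comm_ring_1))"
  by (intro module_hom.intro module_fscale module_hom_axioms.intro poly_mapping_eqI)
    (auto simp: lookup_add algebra_simps)

lemma module_hom_times_left:
  "module_hom fscale fscale (\<lambda>x. x * (y :: 'i word \<Rightarrow>\<^sub>0 'r::comm_ring_1))"
  by (intro module_hom.intro module_fscale module_hom_axioms.intro)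
    (simp_all add: fscale_conv_mult algebra_simps)

lemma single_0_commute:
  fixes x :: "'i word \<Rightarrow>\<^sub>0 'r::comm_ring_1"
  shows "Poly_Mapping.single 0 c * x = x * Poly_Mapping.single 0 c"
proof -
  have "fscale c x = (\<Sum>b\<in>Poly_Mapping.keys x. Poly_Mapping.single 0 c *
      fscale (Poly_Mapping.lookup x b) (Poly_Mapping.single b 1))"
    by (subst poly_mapping_sum_single[of x])
      (simp add: fscale_conv_mult[of c] sum_distrib_left del: fscale_single)
  also have "\<dots> = (\<Sum>b\<in>Poly_Mapping.keys x.
      fscale (Poly_Mapping.lookup x b) (Poly_Mapping.single b 1)) * Poly_Mapping.single 0 c"
    by (simp add: sum_distrib_right mult_single mult.commute)
  also have "\<dots> = x * Poly_Mapping.single 0 c"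
    using poly_mapping_sum_single[of x] by simp
  finally show ?thesis by (simp add: fscale_conv_mult)
qed

lemma module_hom_times_right:
  "module_hom fscale fscale (\<lambda>y. (x :: 'i word \<Rightarrow>\<^sub>0 'r::comm_ring_1) * y)"
  by (intro module_hom.intro module_fscale module_hom_axioms.intro)
    (simp_all add: fscale_conv_mult distrib_left single_0_commute mult.assoc)

text \<open>
  The tensor product of two free modules, realised as the free module on the product
  of their bases; \<open>tensor_universal\<close> below is its universal property.
\<close>

definition tensor :: "('b \<Rightarrow>\<^sub>0 'r::comm_ring_1) \<Rightarrow> ('c \<Rightarrow>\<^sub>0 'r) \<Rightarrow> ('b \<times> 'c \<Rightarrow>\<^sub>0 'r)"
    (infixl "\<otimes>" 75) where
  "x \<otimes> y = (\<Sum>u\<in>Poly_Mapping.keys x. \<Sum>v\<in>Poly_Mapping.keys y.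
     Poly_Mapping.single (u, v) (Poly_Mapping.lookup x u * Poly_Mapping.lookup y v))"

lemma lookup_tensor:
  "Poly_Mapping.lookup (x \<otimes> y) (u, v) = Poly_Mapping.lookup x u * Poly_Mapping.lookup y v"
proof -
  have *: "(if a = u \<and> b = v then c else 0) = (if a = u then (if b = v then c else 0) else 0)"
    for a b c by simp
  have "Poly_Mapping.lookup (x \<otimes> y) (u, v) = (\<Sum>a\<in>Poly_Mapping.keys x. \<Sum>b\<in>Poly_Mapping.keys y.
      if a = u then (if b = v then Poly_Mapping.lookup x a * Poly_Mapping.lookup y b else 0) else 0)"
    unfolding tensor_def by (simp add: lookup_sum lookup_single when_def *)
  also have "\<dots> = (\<Sum>a\<in>Poly_Mapping.keys x. if a = u then
      (\<Sum>b\<in>Poly_Mapping.keys y. if b = v then Poly_Mapping.lookup x a * Poly_Mapping.lookup y b else 0) else 0)"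
    by (intro sum.cong refl) auto
  also have "\<dots> = Poly_Mapping.lookup x u * Poly_Mapping.lookup y v"
    by (simp add: sum.delta in_keys_iff)
  finally show ?thesis .
qed

lemma tensor_single:
  "Poly_Mapping.single u c \<otimes> Poly_Mapping.single v d = Poly_Mapping.single (u, v) (c * d)"
proof (rule poly_mapping_eqI)
  fix k show "Poly_Mapping.lookup (Poly_Mapping.single u c \<otimes> Poly_Mapping.single v d) k
      = Poly_Mapping.lookup (Poly_Mapping.single (u, v) (c * d)) k"
    by (cases k) (auto simp: lookup_tensor lookup_single when_def)
qed

lemma module_hom_tensor_left: "module_hom fscale fscale (\<lambda>x. x \<otimes> y)"
  by (intro module_hom.intro module_fscale module_hom_axioms.intro poly_mapping_eqI)
    (auto simp: lookup_tensor lookup_add algebra_simps)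

lemma module_hom_tensor_right: "module_hom fscale fscale (\<lambda>y. x \<otimes> y)"
  by (intro module_hom.intro module_fscale module_hom_axioms.intro poly_mapping_eqI)
    (auto simp: lookup_tensor lookup_add algebra_simps)

theorem tensor_universal:
  fixes f :: "('b \<Rightarrow>\<^sub>0 'r::comm_ring_1) \<Rightarrow> ('c \<Rightarrow>\<^sub>0 'r) \<Rightarrow> 'm::ab_group_add"
  assumes l: "\<And>y. module_hom fscale sc (\<lambda>x. f x y)"
    and r: "\<And>x. module_hom fscale sc (\<lambda>y. f x y)"
  shows "\<exists>!g. module_hom fscale sc g \<and> (\<forall>x y. g (x \<otimes> y) = f x y)"
proof -
  have m: "module sc" using l by (auto simp: module_hom_def)
  define g where "g = lin_extend sc
    (\<lambda>(u, v). f (Poly_Mapping.single u 1) (Poly_Mapping.single v 1))"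
  have g: "module_hom fscale sc g"
    unfolding g_def by (rule module_hom_lin_extend[OF m])
  have "g (x \<otimes> y) = f x y" for x y
  proof (rule module_hom_eqI[of sc "\<lambda>x. g (x \<otimes> y)" "\<lambda>x. f x y"])
    show "module_hom fscale sc (\<lambda>x. g (x \<otimes> y))"
      using module_hom_compose[OF module_hom_tensor_left g] by (simp add: o_def)
    show "module_hom fscale sc (\<lambda>x. f x y)" by (rule l)
    fix u
    show "g (Poly_Mapping.single u 1 \<otimes> y) = f (Poly_Mapping.single u 1) y"
    proof (rule module_hom_eqI[of sc "\<lambda>y. g (Poly_Mapping.single u 1 \<otimes> y)"
          "\<lambda>y. f (Poly_Mapping.single u 1) y"])
      show "module_hom fscale sc (\<lambda>y. g (Poly_Mapping.single u 1 \<otimes> y))"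
        using module_hom_compose[OF module_hom_tensor_right g] by (simp add: o_def)
      show "module_hom fscale sc (\<lambda>y. f (Poly_Mapping.single u 1) y)" by (rule r)
      fix v
      show "g (Poly_Mapping.single u 1 \<otimes> Poly_Mapping.single v 1)
          = f (Poly_Mapping.single u 1) (Poly_Mapping.single v 1)"
        using m by (simp add: tensor_single g_def lin_extend_single module.scale_one)
    qed
  qed
  moreover have "h = g" if "module_hom fscale sc h" "\<forall>x y. h (x \<otimes> y) = f x y" for h
  proof
    fix x show "h x = g x"
    proof (rule module_hom_eqI[OF that(1) g])
      fix b :: "'b \<times> 'c"
      obtain u v where b: "b = (u, v)" by (cases b)
      have "Poly_Mapping.single b 1 = Poly_Mapping.single u 1 \<otimes> Poly_Mapping.single v (1::'r)"
        by (simp add: tensor_single b)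
      then show "h (Poly_Mapping.single b 1) = g (Poly_Mapping.single b 1)"
        using that(2) calculation by simp
    qed
  qed
  ultimately show ?thesis using g by blast
qed

text \<open>The even part of \<open>I\<close> is the complement of \<open>I1\<close>.\<close>

locale super_cartan_datum =
  fixes I1 :: "'i::finite set"
    and a :: "'i \<Rightarrow> 'i \<Rightarrow> int"
    and s :: "'i \<Rightarrow> nat"
  assumes C1: "a i i = 2"
    and C2: "i \<noteq> j \<Longrightarrow> a i j \<le> 0"
    and C3: "a i j = 0 \<longleftrightarrow> a j i = 0"
    and C4: "i \<in> I1 \<Longrightarrow> even (a i j)"
    and C5_pos: "s i > 0"
    and C5_gcd: "Gcd (s ` UNIV) = 1"
    and C5_sym: "int (s i) * a i j = int (s j) * a j i"
    and C6_nonempty: "I1 \<noteq> {}"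
    and C6_odd: "odd (s i) \<longleftrightarrow> i \<in> I1"

definition parity :: "'i set \<Rightarrow> 'i \<Rightarrow> nat" where
  "parity I1 i = (if i \<in> I1 then 1 else 0)"

definition word_parity :: "'i set \<Rightarrow> 'i word \<Rightarrow> nat" where
  "word_parity I1 w = (\<Sum>i\<leftarrow>letters w. parity I1 i) mod 2"

text \<open>The root lattice \<open>Q\<close> is \<^typ>\<open>'i \<Rightarrow>\<^sub>0 int\<close>, with \<open>\<alpha>\<^sub>i = Poly_Mapping.single i 1\<close>.\<close>

definition word_weight :: "'i word \<Rightarrow> ('i \<Rightarrow>\<^sub>0 int)" where
  "word_weight w = (\<Sum>i\<leftarrow>letters w. Poly_Mapping.single i 1)"

definition pairing :: "('i::finite \<Rightarrow> 'i \<Rightarrow> int) \<Rightarrow> ('i \<Rightarrow> nat) \<Rightarrow> ('i \<Rightarrow>\<^sub>0 int) \<Rightarrow> ('i \<Rightarrow>\<^sub>0 int) \<Rightarrow> int"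
  where
  "pairing a s \<mu> \<nu> = (\<Sum>i\<in>UNIV. \<Sum>j\<in>UNIV.
     Poly_Mapping.lookup \<mu> i * Poly_Mapping.lookup \<nu> j * (int (s i) * a i j))"

definition has_parity :: "'i set \<Rightarrow> nat \<Rightarrow> 'i free_alg \<Rightarrow> bool" where
  "has_parity I1 e x \<longleftrightarrow> (\<forall>w\<in>Poly_Mapping.keys x. word_parity I1 w = e)"

definition has_weight :: "('i \<Rightarrow>\<^sub>0 int) \<Rightarrow> 'i free_alg \<Rightarrow> bool" where
  "has_weight \<nu> x \<longleftrightarrow> (\<forall>w\<in>Poly_Mapping.keys x. word_weight w = \<nu>)"

type_synonym 'i free_alg2 = "'i word \<times> 'i word \<Rightarrow>\<^sub>0 coeff_ring"

definition twist ::
  "('i::finite \<Rightarrow> 'i \<Rightarrow> int) \<Rightarrow> ('i \<Rightarrow> nat) \<Rightarrow> nat \<Rightarrow> ('i \<Rightarrow>\<^sub>0 int) \<Rightarrow> nat \<Rightarrow> ('i \<Rightarrow>\<^sub>0 int) \<Rightarrow> coeff_ring"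
  where
  "twist a s e \<mu> e' \<nu> = pi_var ^ (e * e') * of_base (qvar powi (- pairing a s \<mu> \<nu>))"

text \<open>
  The product of the tensor square of the free algebra, given on pairs of words and
  extended bilinearly; \<open>tmult_tensor_homogeneous\<close> is the formula for arbitrary
  homogeneous elements. It is not the class multiplication on \<^typ>\<open>'i free_alg2\<close>.
\<close>

definition tmult ::
  "'i set \<Rightarrow> ('i::finite \<Rightarrow> 'i \<Rightarrow> int) \<Rightarrow> ('i \<Rightarrow> nat) \<Rightarrow> 'i free_alg2 \<Rightarrow> 'i free_alg2 \<Rightarrow> 'i free_alg2"
  where
  "tmult I1 a s X Y =
     lin_extend fscale (\<lambda>(u, v). lin_extend fscale (\<lambda>(u', v').
       Poly_Mapping.single (u + u', v + v')
         (twist a s (word_parity I1 v) (word_weight v) (word_parity I1 u') (word_weight u'))) Y) X"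

lemma module_hom_tmult_left: "module_hom fscale fscale (\<lambda>X. tmult I1 a s X Y)"
  unfolding tmult_def by (rule module_hom_lin_extend[OF module_fscale])

lemma module_hom_tmult_right: "module_hom fscale fscale (\<lambda>Y. tmult I1 a s X Y)"
proof -
  let ?F = "\<lambda>(u, v) Y. lin_extend fscale (\<lambda>(u', v').
       Poly_Mapping.single (u + u', v + v')
         (twist a s (word_parity I1 v) (word_weight v) (word_parity I1 u') (word_weight u'))) Y"
  have F: "module_hom fscale fscale (?F b)" for b
    by (cases b) (simp add: module_hom_lin_extend[OF module_fscale])
  have "tmult I1 a s X = (\<lambda>Y. \<Sum>b\<in>Poly_Mapping.keys X. fscale (Poly_Mapping.lookup X b) (?F b Y))"
    unfolding tmult_def by (subst lin_extend_def) (simp add: case_prod_unfold fun_eq_iff)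
  moreover have "module_hom fscale fscale
      (\<lambda>Y. \<Sum>b\<in>Poly_Mapping.keys X. fscale (Poly_Mapping.lookup X b) (?F b Y))"
    (is "module_hom _ _ ?G")
  proof (intro module_hom.intro module_fscale module_hom_axioms.intro)
    fix Y Z
    show "?G (Y + Z) = ?G Y + ?G Z"
      by (simp only: module_hom.add[OF F] module.scale_right_distrib[OF module_fscale] sum.distrib)
  next
    fix c Y
    show "?G (fscale c Y) = fscale c (?G Y)"
      by (simp only: module_hom.scale[OF F] module.scale_sum_right[OF module_fscale]
          module.scale_left_commute[OF module_fscale, of c])
  qed
  ultimately show ?thesis by simp
qed

lemma tmult_single:
  "tmult I1 a s (Poly_Mapping.single (u, v) c) (Poly_Mapping.single (u', v') d) =
   Poly_Mapping.single (u + u', v + v')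
     (c * d * twist a s (word_parity I1 v) (word_weight v) (word_parity I1 u') (word_weight u'))"
  by (simp add: tmult_def lin_extend_single[OF module_fscale] mult.assoc)

theorem tmult_tensor_homogeneous:
  assumes "has_parity I1 e x\<^sub>2" "has_weight \<mu> x\<^sub>2" "has_parity I1 e' x\<^sub>1'" "has_weight \<nu> x\<^sub>1'"
  shows "tmult I1 a s (x\<^sub>1 \<otimes> x\<^sub>2) (x\<^sub>1' \<otimes> x\<^sub>2') =
         fscale (twist a s e \<mu> e' \<nu>) ((x\<^sub>1 * x\<^sub>1') \<otimes> (x\<^sub>2 * x\<^sub>2'))"
proof -
  note homs = module_hom_compose[unfolded o_def, OF _ module_hom_fscale]
    module_hom_compose[unfolded o_def, OF _ module_hom_tmult_left]
    module_hom_compose[unfolded o_def, OF _ module_hom_tmult_right]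
  note inner = module_hom_tensor_left module_hom_tensor_right
    module_hom_compose[unfolded o_def, OF module_hom_times_left module_hom_tensor_left]
    module_hom_compose[unfolded o_def, OF module_hom_times_right module_hom_tensor_left]
    module_hom_compose[unfolded o_def, OF module_hom_times_left module_hom_tensor_right]
    module_hom_compose[unfolded o_def, OF module_hom_times_right module_hom_tensor_right]
  let ?R = "\<lambda>x\<^sub>1 x\<^sub>2 x\<^sub>1' x\<^sub>2'. fscale (twist a s e \<mu> e' \<nu>) ((x\<^sub>1 * x\<^sub>1') \<otimes> (x\<^sub>2 * x\<^sub>2'))"
  let ?L = "\<lambda>x\<^sub>1 x\<^sub>2 x\<^sub>1' x\<^sub>2'. tmult I1 a s (x\<^sub>1 \<otimes> x\<^sub>2) (x\<^sub>1' \<otimes> x\<^sub>2')"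
  have "?L x\<^sub>1 x\<^sub>2 x\<^sub>1' x\<^sub>2' = ?R x\<^sub>1 x\<^sub>2 x\<^sub>1' x\<^sub>2'"
  proof (rule module_hom_eqI[of fscale "\<lambda>x\<^sub>1. ?L x\<^sub>1 x\<^sub>2 x\<^sub>1' x\<^sub>2'" "\<lambda>x\<^sub>1. ?R x\<^sub>1 x\<^sub>2 x\<^sub>1' x\<^sub>2'"])
    fix u
    let ?u = "Poly_Mapping.single u 1 :: 'a free_alg"
    show "?L ?u x\<^sub>2 x\<^sub>1' x\<^sub>2' = ?R ?u x\<^sub>2 x\<^sub>1' x\<^sub>2'"
    proof (rule module_hom_eqI_keys[of fscale "\<lambda>x\<^sub>2. ?L ?u x\<^sub>2 x\<^sub>1' x\<^sub>2'" "\<lambda>x\<^sub>2. ?R ?u x\<^sub>2 x\<^sub>1' x\<^sub>2'"])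
      fix v assume v: "v \<in> Poly_Mapping.keys x\<^sub>2"
      let ?v = "Poly_Mapping.single v 1 :: 'a free_alg"
      show "?L ?u ?v x\<^sub>1' x\<^sub>2' = ?R ?u ?v x\<^sub>1' x\<^sub>2'"
      proof (rule module_hom_eqI_keys[of fscale "\<lambda>x\<^sub>1'. ?L ?u ?v x\<^sub>1' x\<^sub>2'" "\<lambda>x\<^sub>1'. ?R ?u ?v x\<^sub>1' x\<^sub>2'"])
        fix u' assume u': "u' \<in> Poly_Mapping.keys x\<^sub>1'"
        let ?u' = "Poly_Mapping.single u' 1 :: 'a free_alg"
        show "?L ?u ?v ?u' x\<^sub>2' = ?R ?u ?v ?u' x\<^sub>2'"
        proof (rule module_hom_eqI[of fscale "\<lambda>x\<^sub>2'. ?L ?u ?v ?u' x\<^sub>2'" "\<lambda>x\<^sub>2'. ?R ?u ?v ?u' x\<^sub>2'"])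
          fix v'
          show "?L ?u ?v ?u' (Poly_Mapping.single v' 1) = ?R ?u ?v ?u' (Poly_Mapping.single v' 1)"
            using assms v u'
            by (simp add: tensor_single tmult_single mult_single has_parity_def has_weight_def)
        qed (intro homs inner)+
      qed (intro homs inner)+
    qed (intro homs inner)+
  qed (intro homs inner)+
  then show ?thesis .
qed

lemma pi_var_power_mod: "(pi_var :: 'a::comm_ring_1 pi_ext) ^ (n mod 2) = pi_var ^ n"
proof -
  have "(pi_var :: 'a pi_ext) ^ n = pi_var ^ (2 * (n div 2) + n mod 2)" by simp
  also have "\<dots> = (pi_var * pi_var) ^ (n div 2) * pi_var ^ (n mod 2)"
    by (simp only: power_add power_mult power2_eq_square)
  finally show ?thesis by (simp add: pi_var_square)
qed

lemma qvar_nonzero: "qvar \<noteq> 0"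
  by (simp add: qvar_def eq_fract Zero_fract_def)

lemma pairing_add_left: "pairing a s (\<mu> + \<mu>') \<nu> = pairing a s \<mu> \<nu> + pairing a s \<mu>' \<nu>"
  by (simp add: pairing_def lookup_add algebra_simps sum.distrib)

lemma pairing_add_right: "pairing a s \<mu> (\<nu> + \<nu>') = pairing a s \<mu> \<nu> + pairing a s \<mu> \<nu>'"
  by (simp add: pairing_def lookup_add algebra_simps sum.distrib)

lemma pairing_zero [simp]: "pairing a s 0 \<nu> = 0" "pairing a s \<mu> 0 = 0"
  by (simp_all add: pairing_def)

lemma word_weight_add: "word_weight (u + v) = word_weight u + word_weight v"
  by (simp add: word_weight_def plus_word_def)

lemma word_weight_0 [simp]: "word_weight 0 = 0"
  by (simp add: word_weight_def zero_word_def)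

lemma word_parity_0 [simp]: "word_parity I1 0 = 0"
  by (simp add: word_parity_def zero_word_def)

lemma word_parity_add: "word_parity I1 (u + v) = (word_parity I1 u + word_parity I1 v) mod 2"
  by (simp add: word_parity_def plus_word_def mod_add_eq)

lemma pi_var_power_mod_mult:
  "(pi_var :: 'a::comm_ring_1 pi_ext) ^ (m mod 2 * k) = pi_var ^ (m * k)"
  by (simp add: power_mult pi_var_power_mod)

lemma qvar_powi_neg_add: "qvar powi (- (m + n)) = qvar powi (- m) * qvar powi (- n)"
  unfolding minus_add_distrib by (rule power_int_add) (simp add: qvar_nonzero)

lemma twist_word_add_left:
  "twist a s (word_parity I1 (u + v)) (word_weight (u + v)) e \<nu> =
   twist a s (word_parity I1 u) (word_weight u) e \<nu> *
   twist a s (word_parity I1 v) (word_weight v) e \<nu>"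
  unfolding twist_def word_parity_add word_weight_add pairing_add_left pi_var_power_mod_mult
    qvar_powi_neg_add of_base_mult add_mult_distrib power_add
  by (simp only: mult_ac)

lemma twist_word_add_right:
  "twist a s e \<mu> (word_parity I1 (u + v)) (word_weight (u + v)) =
   twist a s e \<mu> (word_parity I1 u) (word_weight u) *
   twist a s e \<mu> (word_parity I1 v) (word_weight v)"
  unfolding twist_def word_parity_add word_weight_add pairing_add_right mult.commute[of e]
    pi_var_power_mod_mult qvar_powi_neg_add of_base_mult add_mult_distrib power_add
  by (simp only: mult_ac)

theorem tmult_assoc: "tmult I1 a s (tmult I1 a s X Y) Z = tmult I1 a s X (tmult I1 a s Y Z)"
proof -
  let ?m = "tmult I1 a s"
  note homs = module_hom_tmult_left module_hom_tmult_right
    module_hom_compose[unfolded o_def, OF module_hom_tmult_left module_hom_tmult_left]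
    module_hom_compose[unfolded o_def, OF module_hom_tmult_right module_hom_tmult_left]
    module_hom_compose[unfolded o_def, OF module_hom_tmult_left module_hom_tmult_right]
    module_hom_compose[unfolded o_def, OF module_hom_tmult_right module_hom_tmult_right]
  show ?thesis
  proof (rule module_hom_eqI[of fscale "\<lambda>X. ?m (?m X Y) Z" "\<lambda>X. ?m X (?m Y Z)"])
    fix b\<^sub>1
    let ?x = "Poly_Mapping.single b\<^sub>1 1 :: 'a free_alg2"
    show "?m (?m ?x Y) Z = ?m ?x (?m Y Z)"
    proof (rule module_hom_eqI[of fscale "\<lambda>Y. ?m (?m ?x Y) Z" "\<lambda>Y. ?m ?x (?m Y Z)"])
      fix b\<^sub>2
      let ?y = "Poly_Mapping.single b\<^sub>2 1 :: 'a free_alg2"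
      show "?m (?m ?x ?y) Z = ?m ?x (?m ?y Z)"
      proof (rule module_hom_eqI[of fscale "\<lambda>Z. ?m (?m ?x ?y) Z" "\<lambda>Z. ?m ?x (?m ?y Z)"])
        fix b\<^sub>3
        show "?m (?m ?x ?y) (Poly_Mapping.single b\<^sub>3 1) = ?m ?x (?m ?y (Poly_Mapping.single b\<^sub>3 1))"
          by (cases b\<^sub>1; cases b\<^sub>2; cases b\<^sub>3)
            (simp add: tmult_single twist_word_add_left twist_word_add_right add.assoc mult_ac)
      qed (intro homs)+
    qed (intro homs)+
  qed (intro homs)+
qed

lemma twist_zero [simp]: "twist a s 0 0 e \<nu> = 1" "twist a s e \<nu> 0 0 = 1"
  by (simp_all add: twist_def)

lemma tensor_one: "1 \<otimes> 1 = (Poly_Mapping.single (0, 0) 1 :: 'i free_alg2)"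
  by (simp add: tensor_single flip: single_one)

lemma tmult_one_left: "tmult I1 a s (1 \<otimes> 1) X = X"
proof (rule module_hom_eqI[of fscale "\<lambda>X. tmult I1 a s (1 \<otimes> 1) X" "\<lambda>X. X"])
  fix b show "tmult I1 a s (1 \<otimes> 1) (Poly_Mapping.single b 1) = Poly_Mapping.single b 1"
    by (cases b) (simp add: tensor_one tmult_single)
qed (intro module_hom_tmult_right module_hom_ident module.module_hom_ident[OF module_fscale])+

lemma tmult_one_right: "tmult I1 a s X (1 \<otimes> 1) = X"
proof (rule module_hom_eqI[of fscale "\<lambda>X. tmult I1 a s X (1 \<otimes> 1)" "\<lambda>X. X"])
  fix b show "tmult I1 a s (Poly_Mapping.single b 1) (1 \<otimes> 1) = Poly_Mapping.single b 1"
    by (cases b) (simp add: tensor_one tmult_single)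
qed (intro module_hom_tmult_left module.module_hom_ident[OF module_fscale])+

definition comult ::
  "'i set \<Rightarrow> ('i::finite \<Rightarrow> 'i \<Rightarrow> int) \<Rightarrow> ('i \<Rightarrow> nat) \<Rightarrow> 'i free_alg \<Rightarrow> 'i free_alg2"
  where
  "comult I1 a s = lin_extend fscale (\<lambda>w.
     foldr (\<lambda>i. tmult I1 a s (\<theta> i \<otimes> 1 + 1 \<otimes> \<theta> i)) (letters w) (1 \<otimes> 1))"

lemma module_hom_comult: "module_hom fscale fscale (comult I1 a s)"
  unfolding comult_def by (rule module_hom_lin_extend[OF module_fscale])

lemma comult_word:
  "comult I1 a s (Poly_Mapping.single w 1) =
   foldr (\<lambda>i. tmult I1 a s (\<theta> i \<otimes> 1 + 1 \<otimes> \<theta> i)) (letters w) (1 \<otimes> 1)"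
  by (simp add: comult_def lin_extend_single[OF module_fscale] module.scale_one[OF module_fscale])

lemma comult_one: "comult I1 a s 1 = 1 \<otimes> 1"
  using comult_word[of I1 a s 0] unfolding single_one by (simp add: zero_word_def)

lemma comult_gen: "comult I1 a s (\<theta> i) = \<theta> i \<otimes> 1 + 1 \<otimes> \<theta> i"
  unfolding gen_def[of i] comult_word by (simp add: tmult_one_right gen_def)

theorem comult_mult: "comult I1 a s (x * y) = tmult I1 a s (comult I1 a s x) (comult I1 a s y)"
proof (rule module_hom_eqI[of fscale "\<lambda>x. comult I1 a s (x * y)"
      "\<lambda>x. tmult I1 a s (comult I1 a s x) (comult I1 a s y)"])
  fix u
  let ?u = "Poly_Mapping.single u 1 :: 'a free_alg"
  show "comult I1 a s (?u * y) = tmult I1 a s (comult I1 a s ?u) (comult I1 a s y)"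
  proof (rule module_hom_eqI[of fscale "\<lambda>y. comult I1 a s (?u * y)"
        "\<lambda>y. tmult I1 a s (comult I1 a s ?u) (comult I1 a s y)"])
    fix v
    let ?v = "Poly_Mapping.single v 1 :: 'a free_alg"
    let ?f = "foldr (\<lambda>i. tmult I1 a s (\<theta> i \<otimes> 1 + 1 \<otimes> \<theta> i))"
    have "?f l X = tmult I1 a s (?f l (1 \<otimes> 1)) X" for l X
      by (induction l) (simp_all add: tmult_one_left tmult_assoc)
    from this[of "letters u" "?f (letters v) (1 \<otimes> 1)"]
    show "comult I1 a s (?u * ?v) = tmult I1 a s (comult I1 a s ?u) (comult I1 a s ?v)"
      by (simp add: mult_single comult_word plus_word_def)
  qed (intro module_hom_compose[unfolded o_def, OF module_hom_times_right module_hom_comult]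
      module_hom_compose[unfolded o_def, OF module_hom_comult module_hom_tmult_right])+
qed (intro module_hom_compose[unfolded o_def, OF module_hom_times_left module_hom_comult]
    module_hom_compose[unfolded o_def, OF module_hom_comult module_hom_tmult_left])+

theorem comult_unique:
  assumes "module_hom fscale fscale f" "f 1 = 1 \<otimes> 1"
    and "\<And>x y. f (x * y) = tmult I1 a s (f x) (f y)"
    and "\<And>i. f (\<theta> i) = \<theta> i \<otimes> 1 + 1 \<otimes> \<theta> i"
  shows "f = comult I1 a s"
proof
  fix x
  show "f x = comult I1 a s x"
  proof (rule module_hom_eqI[OF assms(1) module_hom_comult])
    fix w
    have "f (Poly_Mapping.single (Word l) 1) = comult I1 a s (Poly_Mapping.single (Word l) 1)" for l
    proof (induction l)
      case Nil
      then show ?case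
        using assms(2) comult_one[of I1 a s] by (simp flip: zero_word_def)
    next
      case (Cons i l)
      have "Poly_Mapping.single (Word (i # l)) 1 = \<theta> i * Poly_Mapping.single (Word l) 1"
        by (simp add: gen_def mult_single plus_word_def)
      then show ?case using Cons by (simp add: assms(3,4) comult_mult comult_gen)
    qed
    then show "f (Poly_Mapping.single w 1) = comult I1 a s (Poly_Mapping.single w 1)"
      by (cases w) simp
  qed
qed

definition bilinear_form :: "(('b \<Rightarrow>\<^sub>0 'r::comm_ring_1) \<Rightarrow> ('b \<Rightarrow>\<^sub>0 'r) \<Rightarrow> 'r) \<Rightarrow> bool" where
  "bilinear_form B \<longleftrightarrow>
     (\<forall>y. module_hom fscale (*) (\<lambda>x. B x y)) \<and> (\<forall>x. module_hom fscale (*) (\<lambda>y. B x y))"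

definition q_idx :: "('i \<Rightarrow> nat) \<Rightarrow> 'i \<Rightarrow> coeff_ring" where
  "q_idx s i = of_base (qvar ^ s i)"

definition pi_idx :: "'i set \<Rightarrow> 'i \<Rightarrow> coeff_ring" where
  "pi_idx I1 i = pi_var ^ parity I1 i"

lemma qvar_power: "qvar ^ n = Fract ([:0, 1:] ^ n) 1"
proof (induction n)
  case 0
  show ?case by (simp only: power_0 One_fract_def)
next
  case (Suc n)
  show ?case
    unfolding power_Suc Suc.IH unfolding qvar_def mult_fract by (simp only: mult_1_right)
qed

lemma qvar_power_neq_1: "n > 0 \<Longrightarrow> qvar ^ n \<noteq> 1"
proof
  assume n: "n > 0" and "qvar ^ n = 1"
  then have "Fract ([:0, 1:] ^ n) 1 = Fract (1 :: rat poly) 1"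
    unfolding qvar_power One_fract_def by blast
  then have "[:0, 1:] ^ n = (1 :: rat poly)"
    by (subst (asm) eq_fract) simp_all
  then have "poly ([:0, 1:] ^ n) 0 = (1 :: rat)" by simp
  then show False using n unfolding poly_power by (simp add: power_0_left)
qed

lemma unit_inv_gen_norm:
  assumes "s i > 0"
  shows "(1 - pi_idx I1 i * (q_idx s i)\<^sup>2) * unit_inv (1 - pi_idx I1 i * (q_idx s i)\<^sup>2) = 1"
proof -
  let ?x = "pi_idx I1 i * (q_idx s i)\<^sup>2"
  let ?c = "1 - qvar ^ (4 * s i)"
  have pp: "pi_idx I1 i * pi_idx I1 i = 1"
    by (simp add: pi_idx_def parity_def pi_var_square)
  have qq: "of_base (qvar ^ n) = of_base qvar ^ n" for n
    by (induction n) (simp_all add: of_base_mult)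
  have "?x * ?x = (pi_idx I1 i * pi_idx I1 i) * (q_idx s i) ^ 4"
    by (simp add: power2_eq_square power4_eq_xxxx mult_ac)
  also have "\<dots> = of_base (qvar ^ (4 * s i))"
    by (simp only: pp q_idx_def qq power_mult[symmetric] mult.commute[of 4] mult_1_left)
  finally have "(1 - ?x) * (1 + ?x) = 1 - of_base (qvar ^ (4 * s i))"
    by (simp add: algebra_simps)
  also have "\<dots> = of_base ?c"
    using of_base_add[of ?c "qvar ^ (4 * s i)"] by (simp add: diff_eq_eq)
  finally have "(1 - ?x) * ((1 + ?x) * of_base (inverse ?c)) = of_base (?c * inverse ?c)"
    by (simp only: of_base_mult mult.assoc[symmetric])
  also have "?c * inverse ?c = 1"
    using qvar_power_neq_1[of "4 * s i"] assms by simp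
  finally have *: "(1 - ?x) * ((1 + ?x) * of_base (inverse ?c)) = 1" by simp
  show ?thesis using * unit_inv_eqI[OF *] by simp
qed

text \<open>
  \<open>T\<close> is the induced form on the tensor square; bilinearity and its values on pure
  tensors determine it.
\<close>

definition adapted_form ::
  "'i set \<Rightarrow> ('i::finite \<Rightarrow> 'i \<Rightarrow> int) \<Rightarrow> ('i \<Rightarrow> nat) \<Rightarrow> ('i free_alg \<Rightarrow> 'i free_alg \<Rightarrow> coeff_ring) \<Rightarrow> bool"
  where
  "adapted_form I1 a s B \<longleftrightarrow>
     bilinear_form B \<and> B 1 1 = 1 \<and>
     (\<forall>i j. B (\<theta> i) (\<theta> j) =
        (if i = j then unit_inv (1 - pi_idx I1 i * (q_idx s i)\<^sup>2) else 0)) \<and>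
     (\<exists>T. bilinear_form T \<and>
        (\<forall>x' x'' y' y''. T (x' \<otimes> x'') (y' \<otimes> y'') = B x' y' * B x'' y'') \<and>
        (\<forall>x y' y''. B x (y' * y'') = T (comult I1 a s x) (y' \<otimes> y'')) \<and>
        (\<forall>x x' y''. B (x * x') y'' = T (x \<otimes> x') (comult I1 a s y'')))"

end

theory Submission
  imports Defs
begin

text \<open>
  Let \<open>r\<^sub>i\<close> be the skew derivation with \<open>r(x) = \<theta>\<^sub>i \<otimes> r\<^sub>i(x) + \<dots>\<close>, where the remaining terms have a
  first factor in other words. The axioms force \<open>(x, 1)\<close> to be the constant coefficient of \<open>x\<close>
  and \<open>(x, \<theta>\<^sub>i y) = (\<theta>\<^sub>i, \<theta>\<^sub>i) (r\<^sub>i(x), y)\<close>; this recursion gives uniqueness and is taken as the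
  definition for existence. Property (b) then reduces to \<open>r(r\<^sub>i(x)) = (r\<^sub>i \<otimes> 1)(r(x))\<close>. Since the
  pairing on the root lattice is symmetric, so is the twist between two generators; this yields the
  mirrored recursion \<open>(\<theta>\<^sub>i x, y) = (\<theta>\<^sub>i, \<theta>\<^sub>i) (x, r\<^sub>i(y))\<close>, hence symmetry of the form, and (c) is
  (b) read through symmetry.
\<close>

section \<open>Induction principles for free modules, the free algebra and tensor products\<close>

lemma poly_mapping_additive_induct:
  assumes "\<And>b c. P (Poly_Mapping.single b c)" "\<And>x y. P x \<Longrightarrow> P y \<Longrightarrow> P (x + y)"
  shows "P (x :: 'b \<Rightarrow>\<^sub>0 'r::comm_ring_1)"
proof -
  have "P (\<Sum>b\<in>A. fscale (Poly_Mapping.lookup x b) (Poly_Mapping.single b 1))" if "finite A" for A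
    using that
  proof (induction A)
    case empty
    \<comment> \<open>The empty sum is a monomial with coefficient 0, so zero needs no case of its
      own.\<close>
    show ?case using assms(1)[of undefined 0] by simp
  next
    case (insert b A)
    then show ?case by (simp add: assms)
  qed
  then show ?thesis using poly_mapping_sum_single[of x] by (metis finite_keys)
qed

text \<open>Words grow by a letter on the left, which matches the recursions for the coproduct and
  the skew derivations.\<close>

lemma free_alg_induct [case_names one gen_mult add scale]:
  fixes x :: "'i free_alg"
  assumes one: "P 1"
    and gen_mult: "\<And>i x. P x \<Longrightarrow> P (\<theta> i * x)"
    and add: "\<And>x y. P x \<Longrightarrow> P y \<Longrightarrow> P (x + y)"
    and scale: "\<And>c x. P x \<Longrightarrow> P (fscale c x)"
  shows "P x"
proof (induction x rule: poly_mapping_additive_induct)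
  case (1 b c)
  have "P (Poly_Mapping.single (Word l) 1)" for l
  proof (induction l)
    case Nil
    then show ?case using one by (simp flip: zero_word_def)
  next
    case (Cons i l)
    have "Poly_Mapping.single (Word (i # l)) 1 = \<theta> i * Poly_Mapping.single (Word l) 1"
      by (simp add: gen_def mult_single plus_word_def)
    then show ?case using gen_mult[OF Cons] by simp
  qed
  then have "P (fscale c (Poly_Mapping.single (Word (letters b)) 1))" by (rule scale)
  then show ?case by simp
qed (rule add)

text \<open>Scalars are absorbed into the first factor, so sums of pure tensors exhaust the
  module.\<close>

lemma tensor_induct [case_names tensor add]:
  fixes X :: "'b \<times> 'c \<Rightarrow>\<^sub>0 'r::comm_ring_1"
  assumes "\<And>x y. P (x \<otimes> y)" "\<And>X Y. P X \<Longrightarrow> P Y \<Longrightarrow> P (X + Y)"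
  shows "P X"
proof (induction X rule: poly_mapping_additive_induct)
  case (1 b c)
  have "Poly_Mapping.single b c = Poly_Mapping.single (fst b) c \<otimes> Poly_Mapping.single (snd b) 1"
    by (simp add: tensor_single)
  then show ?case using assms(1) by simp
qed (rule assms(2))

lemmas tensor_simps =
  module_hom.add[OF module_hom_tensor_left] module_hom.add[OF module_hom_tensor_right]
  module_hom.scale[OF module_hom_tensor_left] module_hom.scale[OF module_hom_tensor_right]
  module_hom.zero[OF module_hom_tensor_left] module_hom.zero[OF module_hom_tensor_right]

lemmas free_alg_scale_simps =
  module_hom.scale[OF module_hom_times_left] module_hom.scale[OF module_hom_times_right]

lemma fscale_simps:
  "fscale c (x + y) = fscale c x + fscale c y"
  "fscale (c + d) x = fscale c x + fscale d x"
  "fscale c (fscale d x) = fscale (c * d) x"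
  "fscale 1 x = x" "fscale 0 x = 0" "fscale c 0 = 0"
  by (rule poly_mapping_eqI; simp add: lookup_add algebra_simps)+

section \<open>Coefficients of words, contractions and maps on the first tensor factor\<close>

lemma lookup_gen_times:
  "Poly_Mapping.lookup (\<theta> j * x) (Word l) =
    (case l of [] \<Rightarrow> 0 | i # l' \<Rightarrow> if i = j then Poly_Mapping.lookup x (Word l') else 0)"
proof (induction x rule: poly_mapping_additive_induct)
  case (1 b c)
  then show ?case
    by (cases b) (auto simp: gen_def mult_single plus_word_def lookup_single when_def split: list.split)
qed (auto simp: distrib_left lookup_add split: list.split)

lemma lookup_one_word: "Poly_Mapping.lookup (1 :: 'i free_alg) (Word l) = (if l = [] then 1 else 0)"
  by (auto simp: single_one[symmetric] lookup_single when_def zero_word_def)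

text \<open>The contraction of the first tensor factor against the dual basis vector of \<open>w\<close>.\<close>

definition slice :: "'b \<Rightarrow> ('b \<times> 'c \<Rightarrow>\<^sub>0 'r::comm_ring_1) \<Rightarrow> ('c \<Rightarrow>\<^sub>0 'r)" where
  "slice w = lin_extend fscale (\<lambda>(u, v). if u = w then Poly_Mapping.single v 1 else 0)"

lemma module_hom_slice: "module_hom fscale fscale (slice w)"
  unfolding slice_def by (rule module_hom_lin_extend[OF module_fscale])

lemma lookup_slice: "Poly_Mapping.lookup (slice w X) v = Poly_Mapping.lookup X (w, v)"
proof (induction X rule: poly_mapping_additive_induct)
  case (1 b c)
  then show ?case
    by (cases b) (auto simp: slice_def lin_extend_single[OF module_fscale] lookup_single when_def)
qed (simp add: module_hom.add[OF module_hom_slice] lookup_add)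

lemma slice_add: "slice w (X + Y) = slice w X + slice w Y"
  by (rule module_hom.add[OF module_hom_slice])

lemma slice_scale: "slice w (fscale c X) = fscale c (slice w X)"
  by (rule module_hom.scale[OF module_hom_slice])

lemma slice_tensor: "slice w (x \<otimes> y) = fscale (Poly_Mapping.lookup x w) y"
  by (rule poly_mapping_eqI) (simp add: lookup_slice lookup_tensor)

text \<open>This is \<open>f \<otimes> id\<close>. Being built from values on basis pairs it is
  always linear; linearity of \<open>f\<close> enters only for its value on pure tensors.\<close>

definition tensor_map_left ::
  "(('b \<Rightarrow>\<^sub>0 'r::comm_ring_1) \<Rightarrow> ('d \<Rightarrow>\<^sub>0 'r)) \<Rightarrow> ('b \<times> 'c \<Rightarrow>\<^sub>0 'r) \<Rightarrow> ('d \<times> 'c \<Rightarrow>\<^sub>0 'r)" where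
  "tensor_map_left f =
     lin_extend fscale (\<lambda>(u, v). f (Poly_Mapping.single u 1) \<otimes> Poly_Mapping.single v 1)"

lemma module_hom_tensor_map_left: "module_hom fscale fscale (tensor_map_left f)"
  unfolding tensor_map_left_def by (rule module_hom_lin_extend[OF module_fscale])

lemma tensor_map_left_add: "tensor_map_left f (X + Y) = tensor_map_left f X + tensor_map_left f Y"
  by (rule module_hom.add[OF module_hom_tensor_map_left])

lemma tensor_map_left_tensor:
  assumes "module_hom fscale fscale f"
  shows "tensor_map_left f (x \<otimes> y) = f x \<otimes> y"
proof (induction x rule: poly_mapping_additive_induct)
  case (1 u c)
  show ?case
  proof (induction y rule: poly_mapping_additive_induct)
    case (1 v d)
    have "f (Poly_Mapping.single u c) \<otimes> Poly_Mapping.single v d =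
        fscale c (f (Poly_Mapping.single u 1)) \<otimes> fscale d (Poly_Mapping.single v 1)"
      using module_hom.scale[OF assms, of c "Poly_Mapping.single u 1"] by simp
    also have "\<dots> = fscale (c * d) (f (Poly_Mapping.single u 1) \<otimes> Poly_Mapping.single v 1)"
      by (simp add: tensor_simps fscale_simps mult.commute del: fscale_single)
    finally show ?case
      by (simp add: tensor_single tensor_map_left_def lin_extend_single[OF module_fscale])
  qed (simp add: tensor_simps tensor_map_left_add)
qed (simp add: tensor_simps tensor_map_left_add module_hom.add[OF assms])

section \<open>Bilinear forms and the induced form on the tensor square\<close>

lemma bilinear_form_simps:
  assumes "bilinear_form B"
  shows "B (x + x') y = B x y + B x' y" "B x (y + y') = B x y + B x y'"
    "B (fscale c x) y = c * B x y" "B x (fscale c y) = c * B x y"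
    "B 0 y = 0" "B x 0 = 0"
proof -
  have l: "module_hom fscale (*) (\<lambda>x. B x y)" and r: "module_hom fscale (*) (\<lambda>y. B x y)" for x y
    using assms by (auto simp: bilinear_form_def)
  show "B (x + x') y = B x y + B x' y" "B (fscale c x) y = c * B x y" "B 0 y = 0"
    using module_hom.add[OF l] module_hom.scale[OF l] module_hom.zero[OF l] by blast+
  show "B x (y + y') = B x y + B x y'" "B x (fscale c y) = c * B x y" "B x 0 = 0"
    using module_hom.add[OF r] module_hom.scale[OF r] module_hom.zero[OF r] by blast+
qed

lemma bilinear_formI:
  fixes B :: "('b \<Rightarrow>\<^sub>0 'r::comm_ring_1) \<Rightarrow> ('b \<Rightarrow>\<^sub>0 'r) \<Rightarrow> 'r"
  assumes "\<And>x x' y. B (x + x') y = B x y + B x' y" "\<And>x y y'. B x (y + y') = B x y + B x y'"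
    "\<And>c x y. B (fscale c x) y = c * B x y" "\<And>c x y. B x (fscale c y) = c * B x y"
  shows "bilinear_form B"
  unfolding bilinear_form_def
  by (intro allI conjI module_hom.intro module_fscale module_mult module_hom_axioms.intro assms)

text \<open>The later witness for the induced form \<open>T\<close>. Fixing it on basis pairs makes
  it bilinear for every \<open>B\<close>; the product rule on pure tensors uses bilinearity of
  \<open>B\<close>.\<close>

definition tensor_form ::
  "(('b \<Rightarrow>\<^sub>0 'r::comm_ring_1) \<Rightarrow> ('b \<Rightarrow>\<^sub>0 'r) \<Rightarrow> 'r) \<Rightarrow> ('b \<times> 'b \<Rightarrow>\<^sub>0 'r) \<Rightarrow> ('b \<times> 'b \<Rightarrow>\<^sub>0 'r) \<Rightarrow> 'r"
  where
  "tensor_form B X Y = lin_extend (*) (\<lambda>(u, v). lin_extend (*) (\<lambda>(u', v').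
     B (Poly_Mapping.single u 1) (Poly_Mapping.single u' 1) *
     B (Poly_Mapping.single v 1) (Poly_Mapping.single v' 1)) Y) X"

lemma lin_extend_pointwise:
  fixes f g :: "'b \<Rightarrow> 'r::comm_ring_1"
  shows "lin_extend (*) (\<lambda>b. f b + g b) x = lin_extend (*) f x + lin_extend (*) g x"
    "lin_extend (*) (\<lambda>b. c * f b) x = c * lin_extend (*) f x"
  by (simp_all add: lin_extend_def algebra_simps sum.distrib sum_distrib_left)

lemmas lin_extend_simps =
  module_hom.add[OF module_hom_lin_extend[OF module_mult]]
  module_hom.scale[OF module_hom_lin_extend[OF module_mult]]

lemma bilinear_tensor_form: "bilinear_form (tensor_form B)"
  by (rule bilinear_formI)
    (simp_all add: tensor_form_def lin_extend_simps lin_extend_pointwise case_prod_unfold)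

lemma tensor_form_tensor:
  assumes B: "bilinear_form B"
  shows "tensor_form B (x \<otimes> y) (x' \<otimes> y') = B x x' * B y y'"
proof -
  note simps = tensor_simps bilinear_form_simps[OF bilinear_tensor_form] bilinear_form_simps[OF B]
    algebra_simps
  have single: "Poly_Mapping.single b c = fscale c (Poly_Mapping.single b 1)" for b :: 'a and c :: 'b
    by simp
  show ?thesis
  proof (induction x rule: poly_mapping_additive_induct)
    case (1 u c)
    show ?case
    proof (induction y rule: poly_mapping_additive_induct)
      case (1 v d)
      show ?case
      proof (induction x' rule: poly_mapping_additive_induct)
        case (1 u' c')
        show ?case
        proof (induction y' rule: poly_mapping_additive_induct)
          case (1 v' d')
          have "tensor_form B (Poly_Mapping.single u c \<otimes> Poly_Mapping.single v d)
              (Poly_Mapping.single u' c' \<otimes> Poly_Mapping.single v' d') = c * d * c' * d' *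
              (B (Poly_Mapping.single u 1) (Poly_Mapping.single u' 1) *
               B (Poly_Mapping.single v 1) (Poly_Mapping.single v' 1))"
            by (simp add: tensor_single tensor_form_def lin_extend_single[OF module_mult] mult_ac)
          then show ?case
            by (simp only: single[of _ c] single[of _ d] single[of _ c'] single[of _ d']
                bilinear_form_simps[OF B] mult_ac)
        qed (simp add: simps)
      qed (simp add: simps)
    qed (simp add: simps)
  qed (simp add: simps)
qed

lemma tensor_form_symmetric:
  assumes B: "bilinear_form B" and sym: "\<And>x y. B x y = B y x"
  shows "tensor_form B X Y = tensor_form B Y X"
proof (induction X rule: tensor_induct)
  case (tensor x y)
  show ?case
    by (induction Y rule: tensor_induct)
      (simp_all add: tensor_form_tensor[OF B] bilinear_form_simps[OF bilinear_tensor_form] sym)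
qed (simp add: bilinear_form_simps[OF bilinear_tensor_form])

section \<open>The twist produced by a generator\<close>

context
  fixes I1 :: "'i::finite set"
    and a :: "'i \<Rightarrow> 'i \<Rightarrow> int"
    and s :: "'i \<Rightarrow> nat"
begin

text \<open>The scalar in the product of \<open>1 \<otimes> \<theta> j\<close> with
  \<open>w \<otimes> 1\<close>: \<pi> to the product of the parities, times q to minus the pairing
  of the weights.\<close>

definition gen_twist :: "'i \<Rightarrow> 'i word \<Rightarrow> coeff_ring" where
  "gen_twist j w = twist a s (word_parity I1 (Word [j])) (word_weight (Word [j]))
     (word_parity I1 w) (word_weight w)"

lemma gen_twist_0 [simp]: "gen_twist j 0 = 1"
  by (simp add: gen_twist_def)

lemma gen_twist_add: "gen_twist j (u + v) = gen_twist j u * gen_twist j v"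
  by (simp add: gen_twist_def twist_word_add_right)

text \<open>The automorphism by which \<open>\<theta>\<^sub>j\<close> in the second tensor factor moves past the first factor.\<close>

definition twist_aut :: "'i \<Rightarrow> 'i free_alg \<Rightarrow> 'i free_alg" where
  "twist_aut j = lin_extend fscale (\<lambda>w. Poly_Mapping.single w (gen_twist j w))"

lemma module_hom_twist_aut: "module_hom fscale fscale (twist_aut j)"
  unfolding twist_aut_def by (rule module_hom_lin_extend[OF module_fscale])

lemmas twist_aut_linear =
  module_hom.add[OF module_hom_twist_aut] module_hom.scale[OF module_hom_twist_aut]
  module_hom.zero[OF module_hom_twist_aut]

lemma twist_aut_single:
  "twist_aut j (Poly_Mapping.single w c) = Poly_Mapping.single w (c * gen_twist j w)"
  by (simp add: twist_aut_def lin_extend_single[OF module_fscale])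

lemma lookup_twist_aut:
  "Poly_Mapping.lookup (twist_aut j x) w = gen_twist j w * Poly_Mapping.lookup x w"
  by (induction x rule: poly_mapping_additive_induct)
    (auto simp: twist_aut_single lookup_single when_def twist_aut_linear lookup_add algebra_simps)

lemma twist_aut_1: "twist_aut j 1 = 1"
  by (simp add: twist_aut_single flip: single_one)

lemma twist_aut_gen_times:
  "twist_aut j (\<theta> i * x) = fscale (gen_twist j (Word [i])) (\<theta> i * twist_aut j x)"
  by (induction x rule: poly_mapping_additive_induct)
    (simp_all add: gen_def mult_single twist_aut_single gen_twist_add mult_ac distrib_left
      twist_aut_linear fscale_simps)

lemmas tmult_simps =
  module_hom.add[OF module_hom_tmult_left] module_hom.add[OF module_hom_tmult_right]
  module_hom.scale[OF module_hom_tmult_left] module_hom.scale[OF module_hom_tmult_right]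

lemma tmult_gen_left: "tmult I1 a s (\<theta> j \<otimes> 1) (x \<otimes> y) = (\<theta> j * x) \<otimes> y"
proof (induction x rule: poly_mapping_additive_induct)
  case (1 u c)
  show ?case
    by (induction y rule: poly_mapping_additive_induct)
      (simp_all add: gen_def tensor_single tmult_single mult_single tensor_simps tmult_simps
        flip: single_one)
qed (simp add: tensor_simps tmult_simps distrib_left)

lemma tmult_gen_right: "tmult I1 a s (1 \<otimes> \<theta> j) (x \<otimes> y) = twist_aut j x \<otimes> (\<theta> j * y)"
proof (induction x rule: poly_mapping_additive_induct)
  case (1 u c)
  show ?case
    by (induction y rule: poly_mapping_additive_induct)
      (simp_all add: gen_def tensor_single tmult_single mult_single tensor_simps tmult_simps
        twist_aut_single gen_twist_def mult_ac distrib_left flip: single_one)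
qed (simp add: tensor_simps tmult_simps twist_aut_linear)

section \<open>The coproduct and the skew derivations\<close>

lemma comult_gen_times:
  "comult I1 a s (\<theta> j * x) =
     tmult I1 a s (\<theta> j \<otimes> 1) (comult I1 a s x) + tmult I1 a s (1 \<otimes> \<theta> j) (comult I1 a s x)"
  by (simp add: comult_mult comult_gen tmult_simps)

lemmas comult_linear =
  module_hom.add[OF module_hom_comult[of I1 a s]] module_hom.scale[OF module_hom_comult[of I1 a s]]
  module_hom.zero[OF module_hom_comult[of I1 a s]]

text \<open>Counit law. The summand \<open>\<theta> j \<otimes> 1\<close> makes the first factor
  nonempty and drops out; \<open>1 \<otimes> \<theta> j\<close> passes the empty word with scalar
  1.\<close>

lemma slice_0_comult: "slice 0 (comult I1 a s x) = x"
proof (induction x rule: free_alg_induct)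
  case one
  show ?case by (simp add: comult_one slice_tensor lookup_one_word zero_word_def fscale_simps)
next
  case (gen_mult j x)
  have "slice 0 (tmult I1 a s (\<theta> j \<otimes> 1) X) = 0" for X
    by (induction X rule: tensor_induct)
      (simp_all add: tmult_gen_left slice_tensor lookup_gen_times zero_word_def fscale_simps
        tmult_simps slice_add)
  moreover have "slice 0 (tmult I1 a s (1 \<otimes> \<theta> j) X) = \<theta> j * slice 0 X" for X
    by (induction X rule: tensor_induct)
      (simp_all add: tmult_gen_right slice_tensor lookup_twist_aut tmult_simps slice_add
        free_alg_scale_simps distrib_left)
  ultimately show ?case using gen_mult by (simp add: comult_gen_times slice_add)
qed (simp_all add: comult_linear slice_add slice_scale)

text \<open>Lusztig's \<open>\<^sub>ir\<close>, written \<open>r\<^sub>i\<close> above.\<close>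

definition skew_deriv :: "'i \<Rightarrow> 'i free_alg \<Rightarrow> 'i free_alg" where
  "skew_deriv i x = slice (Word [i]) (comult I1 a s x)"

lemma module_hom_skew_deriv: "module_hom fscale fscale (skew_deriv i)"
  unfolding skew_deriv_def
  by (rule module_hom_compose[unfolded o_def, OF module_hom_comult module_hom_slice])

lemmas skew_deriv_linear =
  module_hom.add[OF module_hom_skew_deriv] module_hom.scale[OF module_hom_skew_deriv]
  module_hom.zero[OF module_hom_skew_deriv]

lemma skew_deriv_1: "skew_deriv i 1 = 0"
  by (simp add: skew_deriv_def comult_one slice_tensor lookup_one_word fscale_simps)

text \<open>Twisted Leibniz rule. The first factor becomes the word \<open>i\<close> either by
  prepending \<open>j = i\<close> to the empty word, where the counit law returns \<open>x\<close>,
  or because \<open>\<theta> j\<close> has moved past an \<open>i\<close> already there.\<close>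

lemma skew_deriv_gen_times:
  "skew_deriv i (\<theta> j * x) =
     (if i = j then x else 0) + fscale (gen_twist j (Word [i])) (\<theta> j * skew_deriv i x)"
proof -
  have "slice (Word [i]) (tmult I1 a s (\<theta> j \<otimes> 1) X) = (if i = j then slice 0 X else 0)" for X
    by (induction X rule: tensor_induct)
      (simp_all add: tmult_gen_left slice_tensor lookup_gen_times zero_word_def fscale_simps
        tmult_simps slice_add)
  moreover have "slice (Word [i]) (tmult I1 a s (1 \<otimes> \<theta> j) X) =
      fscale (gen_twist j (Word [i])) (\<theta> j * slice (Word [i]) X)" for X
    by (induction X rule: tensor_induct)
      (simp_all add: tmult_gen_right slice_tensor lookup_twist_aut tmult_simps slice_add
        free_alg_scale_simps distrib_left fscale_simps mult_ac)
  ultimately show ?thesis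
    by (simp add: skew_deriv_def comult_gen_times slice_add slice_0_comult)
qed

text \<open>The twist is multiplicative along words, so deleting one letter \<open>i\<close> changes
  it by exactly the factor of that letter.\<close>

lemma skew_deriv_twist_aut:
  "skew_deriv i (twist_aut j x) = fscale (gen_twist j (Word [i])) (twist_aut j (skew_deriv i x))"
proof (induction x rule: free_alg_induct)
  case one
  show ?case by (simp add: twist_aut_1 skew_deriv_1 twist_aut_linear fscale_simps)
next
  case (gen_mult k x)
  then show ?case
    by (simp add: twist_aut_gen_times skew_deriv_gen_times skew_deriv_linear twist_aut_linear
        fscale_simps free_alg_scale_simps mult_ac)
qed (simp_all add: skew_deriv_linear twist_aut_linear fscale_simps mult_ac)

text \<open>The part of coassociativity in which the first tensor factor has degree one.\<close>

lemma comult_skew_deriv: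
  "comult I1 a s (skew_deriv i x) = tensor_map_left (skew_deriv i) (comult I1 a s x)"
proof (induction x rule: free_alg_induct)
  case one
  show ?case
    by (simp add: skew_deriv_1 comult_linear comult_one tensor_simps
        tensor_map_left_tensor[OF module_hom_skew_deriv])
next
  case (gen_mult j x)
  let ?c = "gen_twist j (Word [i])"
  let ?D = "tensor_map_left (skew_deriv i) :: 'i free_alg2 \<Rightarrow> _"
  note tensor = tensor_map_left_tensor[OF module_hom_skew_deriv]
  have "?D (tmult I1 a s (\<theta> j \<otimes> 1) X) =
      (if i = j then X else 0) + fscale ?c (tmult I1 a s (\<theta> j \<otimes> 1) (?D X))" for X
    by (induction X rule: tensor_induct)
      (simp_all add: tmult_gen_left tensor skew_deriv_gen_times tensor_simps tmult_simps
        tensor_map_left_add fscale_simps)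
  \<comment> \<open>Here the scalar arises from commuting the derivation with
    \<open>twist_aut j\<close>. It equals the one from the Leibniz rule above, so both terms
    recombine into the coproduct of \<open>\<theta> j * skew_deriv i x\<close>.\<close>
  moreover have "?D (tmult I1 a s (1 \<otimes> \<theta> j) X) = fscale ?c (tmult I1 a s (1 \<otimes> \<theta> j) (?D X))" for X
    by (induction X rule: tensor_induct)
      (simp_all add: tmult_gen_right tensor skew_deriv_twist_aut tensor_simps tmult_simps
        tensor_map_left_add fscale_simps)
  ultimately show ?case
    using gen_mult
    by (simp add: comult_gen_times skew_deriv_gen_times comult_linear tensor_map_left_add
        fscale_simps algebra_simps)
qed (simp_all add: skew_deriv_linear comult_linear tensor_map_left_add
    module_hom.scale[OF module_hom_tensor_map_left])

section \<open>The canonical form and property (b)\<close>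

definition gen_norm :: "'i \<Rightarrow> coeff_ring" where
  "gen_norm i = unit_inv (1 - pi_idx I1 i * (q_idx s i)\<^sup>2)"

text \<open>The prospective value of \<open>(x, w)\<close> for the word \<open>w\<close> with the
  given letters. Words are a basis, so prescribing it on each of them is consistent.\<close>

primrec word_form :: "'i list \<Rightarrow> 'i free_alg \<Rightarrow> coeff_ring" where
  "word_form [] x = Poly_Mapping.lookup x 0"
| "word_form (i # l) x = gen_norm i * word_form l (skew_deriv i x)"

definition canonical_form :: "'i free_alg \<Rightarrow> 'i free_alg \<Rightarrow> coeff_ring" where
  "canonical_form x y = lin_extend (*) (\<lambda>w. word_form (letters w) x) y"

lemma word_form_linear:
  "word_form l (x + y) = word_form l x + word_form l y"
  "word_form l (fscale c x) = c * word_form l x"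
  by (induction l arbitrary: x y)
    (simp_all add: lookup_add skew_deriv_linear algebra_simps)

lemma bilinear_canonical_form: "bilinear_form canonical_form"
  by (rule bilinear_formI)
    (simp_all add: canonical_form_def lin_extend_simps lin_extend_pointwise word_form_linear)

lemmas canonical_form_simps = bilinear_form_simps[OF bilinear_canonical_form]

lemma canonical_form_one: "canonical_form x 1 = Poly_Mapping.lookup x 0"
  by (simp add: canonical_form_def lin_extend_single[OF module_mult] zero_word_def
      flip: single_one)

lemma canonical_form_gen_times:
  "canonical_form x (\<theta> i * y) = gen_norm i * canonical_form (skew_deriv i x) y"
proof (induction y rule: poly_mapping_additive_induct)
  case (1 w c)
  then show ?case
    by (simp add: canonical_form_def gen_def mult_single lin_extend_single[OF module_mult]
        plus_word_def mult_ac)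
qed (simp add: distrib_left canonical_form_simps)

lemma canonical_form_gen: "canonical_form (\<theta> i) (\<theta> j) = (if i = j then gen_norm i else 0)"
  using canonical_form_gen_times[of "\<theta> i" j 1] skew_deriv_gen_times[of j i 1]
  by (simp add: canonical_form_one skew_deriv_1 fscale_simps lookup_one_word zero_word_def)

text \<open>Induction on \<open>y\<close> with \<open>x\<close> arbitrary, since each letter taken
  off \<open>y\<close> differentiates \<open>x\<close>. The base case is the counit law, the step is
  \<open>comult_skew_deriv\<close>.\<close>

lemma canonical_form_times_right:
  "canonical_form x (y * z) = tensor_form canonical_form (comult I1 a s x) (y \<otimes> z)"
proof -
  let ?T = "tensor_form canonical_form"
  note tensor = tensor_form_tensor[OF bilinear_canonical_form]
    and T_simps = bilinear_form_simps[OF bilinear_tensor_form]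
  show ?thesis
  proof (induction y arbitrary: x rule: free_alg_induct)
    case one
    \<comment> \<open>Pairing the first factor with 1 extracts its constant coefficient.\<close>
    have "?T X (1 \<otimes> z) = canonical_form (slice 0 X) z" for X
      by (induction X rule: tensor_induct)
        (simp_all add: tensor T_simps slice_tensor slice_add canonical_form_one canonical_form_simps)
    then show ?case by (simp add: slice_0_comult)
  next
    case (gen_mult i y)
    have "?T X ((\<theta> i * y) \<otimes> z) = gen_norm i * ?T (tensor_map_left (skew_deriv i) X) (y \<otimes> z)" for X
      by (induction X rule: tensor_induct)
        (simp_all add: tensor T_simps tensor_map_left_add canonical_form_gen_times
          tensor_map_left_tensor[OF module_hom_skew_deriv] algebra_simps)
    then show ?case
      using gen_mult by (simp add: mult.assoc canonical_form_gen_times comult_skew_deriv)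
  qed (simp_all add: distrib_right canonical_form_simps free_alg_scale_simps tensor_simps T_simps)
qed

section \<open>Uniqueness\<close>

text \<open>Property (c) evaluates the form against 1 and the generators, where the coproduct is
  explicit; (b) with first factor \<open>\<theta> i\<close> then gives the recursion.\<close>

lemma adapted_form_gen_times:
  assumes "adapted_form I1 a s B"
  shows "B x 1 = Poly_Mapping.lookup x 0"
    and "B x (\<theta> i * y) = gen_norm i * B (skew_deriv i x) y"
proof -
  from assms obtain T where B: "bilinear_form B" and one: "B 1 1 = 1"
    and gen: "\<And>i j. B (\<theta> i) (\<theta> j) = (if i = j then gen_norm i else 0)"
    and T: "bilinear_form T" "\<And>x' x'' y' y''. T (x' \<otimes> x'') (y' \<otimes> y'') = B x' y' * B x'' y''"
    and right: "\<And>x y' y''. B x (y' * y'') = T (comult I1 a s x) (y' \<otimes> y'')"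
    and left: "\<And>x x' y''. B (x * x') y'' = T (x \<otimes> x') (comult I1 a s y'')"
    unfolding adapted_form_def gen_norm_def by metis
  note simps = bilinear_form_simps[OF B] bilinear_form_simps[OF T(1)] T(2)
  \<comment> \<open>With 1 = 1 * 1, property (b) yields t = t + t for
    \<open>t = B (\<theta> i) 1\<close>, hence t = 0.\<close>
  have gen_one: "B (\<theta> i) 1 = 0" for i
    using right[of "\<theta> i" 1 1] by (simp add: comult_gen simps one)
  show B_one: "B x 1 = Poly_Mapping.lookup x 0" for x
    by (induction x rule: free_alg_induct)
      (simp_all add: one left comult_one simps gen_one lookup_one_word lookup_gen_times
        zero_word_def lookup_add)
  \<comment> \<open>Pairing \<open>\<theta> j \<otimes> x\<close> with the coproduct of
    \<open>\<theta> i\<close> leaves only \<open>B (\<theta> j) (\<theta> i) * B x 1\<close>, by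
    \<open>gen_one\<close>. At \<open>x = 1\<close> the doubling argument applies again, now through
    (c).\<close>
  have B_gen: "B x (\<theta> i) = gen_norm i * Poly_Mapping.lookup x (Word [i])" for x i
  proof (induction x rule: free_alg_induct)
    case one
    show ?case
      using left[of 1 1 "\<theta> i"] by (simp add: comult_gen simps \<open>B 1 1 = 1\<close> lookup_one_word)
  next
    case (gen_mult j x)
    have "Poly_Mapping.lookup (\<theta> j) (Word []) = 0"
      using lookup_gen_times[of j 1 "[]"] by simp
    then show ?case
      by (simp add: left comult_gen simps gen gen_one B_one lookup_gen_times zero_word_def)
  qed (simp_all add: simps lookup_add algebra_simps)
  \<comment> \<open>Pairing with \<open>\<theta> i\<close> sees only the coefficient of the word
    \<open>i\<close>, so it is a multiple of the contraction defining
    \<open>skew_deriv i\<close>.\<close>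
  have "T X (\<theta> i \<otimes> y) = gen_norm i * B (slice (Word [i]) X) y" for X
    by (induction X rule: tensor_induct)
      (simp_all add: simps slice_tensor slice_add B_gen algebra_simps)
  then show "B x (\<theta> i * y) = gen_norm i * B (skew_deriv i x) y"
    by (simp add: right skew_deriv_def)
qed

lemma adapted_form_unique:
  assumes "adapted_form I1 a s B"
  shows "B = canonical_form"
proof -
  have "bilinear_form B" using assms by (simp add: adapted_form_def)
  note simps = bilinear_form_simps[OF this]
  have "B x y = canonical_form x y" for x y
    by (induction y arbitrary: x rule: free_alg_induct)
      (simp_all add: simps canonical_form_simps canonical_form_one canonical_form_gen_times
        adapted_form_gen_times[OF assms])
  then show ?thesis by blast
qed

section \<open>Symmetry and existence\<close>

context
  assumes datum: "super_cartan_datum I1 a s"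
begin

lemma gen_twist_gen_commute: "gen_twist j (Word [i]) = gen_twist i (Word [j])"
proof -
  interpret super_cartan_datum I1 a s by (rule datum)
  have "pairing a s \<mu> \<nu> = pairing a s \<nu> \<mu>" for \<mu> \<nu>
    unfolding pairing_def by (subst sum.swap) (simp add: C5_sym mult_ac)
  then show ?thesis by (simp add: gen_twist_def twist_def mult.commute)
qed

text \<open>For \<open>\<theta> j * y\<close> in place of \<open>y\<close>, the Leibniz rule turns
  both sides into a term in \<open>(x, y)\<close> present when \<open>i = j\<close>, plus a multiple
  of \<open>(r_j x, r_i y)\<close>. The multiples carry the twists of \<open>i\<close> past
  \<open>j\<close> and of \<open>j\<close> past \<open>i\<close>, which agree.\<close>

lemma canonical_form_gen_times_left:
  "canonical_form (\<theta> i * x) y = gen_norm i * canonical_form x (skew_deriv i y)"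
proof (induction y arbitrary: x rule: free_alg_induct)
  case one
  show ?case
    by (simp add: canonical_form_one lookup_gen_times zero_word_def skew_deriv_1 canonical_form_simps)
next
  case (gen_mult j y)
  then show ?case
    by (simp add: canonical_form_gen_times skew_deriv_gen_times canonical_form_simps
        gen_twist_gen_commute[of i j] algebra_simps)
qed (simp_all add: canonical_form_simps skew_deriv_linear algebra_simps)

text \<open>The two recursions mirror each other, which reduces the claim to \<open>y = 1\<close>;
  there both sides are the constant coefficient of \<open>x\<close>, because skew derivations kill
  1.\<close>

lemma canonical_form_symmetric: "canonical_form x y = canonical_form y x"
proof (induction y arbitrary: x rule: free_alg_induct)
  case one
  show ?case
    by (induction x rule: free_alg_induct)
      (simp_all add: canonical_form_simps canonical_form_one canonical_form_gen_times
        lookup_gen_times zero_word_def skew_deriv_1 lookup_add)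
qed (simp_all add: canonical_form_simps canonical_form_gen_times canonical_form_gen_times_left)

lemma adapted_canonical_form: "adapted_form I1 a s canonical_form"
  unfolding adapted_form_def
proof (intro conjI allI exI[of _ "tensor_form canonical_form"])
  fix x x' y
  show "canonical_form (x * x') y = tensor_form canonical_form (x \<otimes> x') (comult I1 a s y)"
    by (subst canonical_form_symmetric, subst tensor_form_symmetric)
      (simp_all add: bilinear_canonical_form canonical_form_symmetric canonical_form_times_right)
qed (simp_all add: bilinear_canonical_form bilinear_tensor_form canonical_form_one
    lookup_one_word zero_word_def canonical_form_gen gen_norm_def
    tensor_form_tensor canonical_form_times_right)

end

end

theorem proposition3p3:
  fixes I1 :: "'i::finite set"
    and a :: "'i \<Rightarrow> 'i \<Rightarrow> int"
    and s :: "'i \<Rightarrow> nat"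
  assumes "super_cartan_datum I1 a s"
  shows "(\<exists>!B. adapted_form I1 a s B) \<and>
    (\<forall>B. adapted_form I1 a s B \<longrightarrow> (\<forall>x y. B x y = B y x))"
  \<comment> \<open>Uniqueness identifies every adapted form with \<open>canonical_form\<close>,
    whose symmetry it inherits.\<close>
  using adapted_canonical_form[OF assms] adapted_form_unique canonical_form_symmetric[OF assms]
  by metis

end
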